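(* If $\lambda>0$ and $f(z)=z+\sum_{n=2}^\infty a_nz^n$ belongs to $\mathcal{H}$, then for each $n\ge2$ we have $$|\lambda a_n^2-a_{2n-1}|\le\max\left\{\frac{\lambda}{n^2},\frac{1}{2n-1}\right\}.$$ Equality holds (for a given $n\ge 2$) if and only if $$f(z)=\begin{cases}z+\frac{\alpha}{2n-1}z^{2n-1},&\text{for }\lambda\le\frac{n^2}{2n-1},\\[4pt] z+\frac{\alpha}{n}z^n,&\text{for }\lambda\ge\frac{n^2}{2n-1},\end{cases}$$ where $\alpha$ is a complex number such that $|\alpha|=1$. In the case $\lambda=\frac{n^2}{2n-1}$ both types of functions are extremal (that is, equality holds if and only if $f$ has one of the two displayed forms for some $\alpha$ with $|\alpha|=1$).
   Context: $\mathbb{D}=\{z\in\mathbb{C}:|z|<1\}$ is the open unit disk and $\mathcal{H}$ (the Hurwitz class) is the set of all functions $f(z)=z+a_2z^2+a_3z^3+\ldots$ analytic in $\mathbb{D}$ with the property that $\sum_{n=2}^\infty n|a_n|\le1$. *)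

theory Defs
  imports "HOL-Complex_Analysis.Complex_Analysis"
begin

text \<open>
  Functions on the open unit disk are total functions of type \<^typ>\<open>complex \<Rightarrow> complex\<close> whose values
  outside \<^term>\<open>ball (0::complex) 1\<close> are irrelevant. Coefficient sequences are indexed so that
  \<open>a n\<close> is the coefficient of \<open>z ^ n\<close>; the series start at exponent 2, so \<open>a 0\<close> and \<open>a 1\<close> are
  never used.
\<close>

definition normalized_expansion :: "(complex \<Rightarrow> complex) \<Rightarrow> (nat \<Rightarrow> complex) \<Rightarrow> bool" where
  "normalized_expansion f a \<longleftrightarrow>
     (\<forall>z\<in>ball 0 1. (\<lambda>k. a (k + 2) * z ^ (k + 2)) sums (f z - z))"

text \<open>The explicit summability is needed because \<^const>\<open>suminf\<close> is unspecified on divergent series.\<close>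

definition hurwitz_class :: "(complex \<Rightarrow> complex) set" where
  "hurwitz_class =
     {f. f analytic_on ball 0 1 \<and>
         (\<exists>a. normalized_expansion f a \<and>
              summable (\<lambda>k. real (k + 2) * norm (a (k + 2))) \<and>
              (\<Sum>k. real (k + 2) * norm (a (k + 2))) \<le> 1)}"

end

theory Submission
  imports Defs
begin

text \<open>
  Put \<open>x = n\<bar>a\<^sub>n\<bar>\<close> and \<open>y = (2n - 1)\<bar>a\<^sub>2\<^sub>n\<^sub>-\<^sub>1\<bar>\<close>. Since \<open>n \<noteq> 2n - 1\<close>, these are two different terms of the
  series that defines the Hurwitz class, so \<open>x + y \<le> 1\<close>. With \<open>p = \<lambda>/n\<^sup>2\<close> and \<open>q = 1/(2n - 1)\<close> the
  triangle inequality bounds the functional by \<open>p x\<^sup>2 + q y\<close>, and as \<open>x\<^sup>2 \<le> x\<close> this is at most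
  \<open>max p q\<close>. The bound is attained only at a corner of the triangle of admissible \<open>(x, y)\<close>:
  at \<open>(0, 1)\<close> if \<open>p \<le> q\<close>, or at \<open>(1, 0)\<close> if \<open>p \<ge> q\<close> (lemma \<open>quadratic_on_triangle\<close>).

  A corner means that a single term \<open>m\<bar>a\<^sub>m\<bar>\<close> uses up the whole budget \<open>1\<close>. All other coefficients
  then vanish, so that \<open>f z = z + (\<alpha>/m) z\<^sup>m\<close> with \<open>\<bar>\<alpha>\<bar> = 1\<close>; conversely the coefficients of such an \<open>f\<close>
  can be read off because power series expansions are unique (lemma
  \<open>hurwitz_coefficient_extremal_iff\<close>). At a corner one of the two summands of the functional is zero,
  so the triangle inequality loses nothing there.
\<close>

lemma normalized_expansion_unique:
  assumes "normalized_expansion f a" and "normalized_expansion f b" and "k \<ge> 2"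
  shows "a k = b k"
proof (rule ccontr)
  assume "a k \<noteq> b k"
  define c where "c i = (if i < 2 then 0 else a i - b i)" for i
  have sums: "(\<lambda>i. c i * z ^ i) sums 0" if "norm z < 1" for z
  proof -
    have "(\<lambda>i. a (i + 2) * z ^ (i + 2)) sums (f z - z)" "(\<lambda>i. b (i + 2) * z ^ (i + 2)) sums (f z - z)"
      using assms that by (auto simp: normalized_expansion_def)
    from sums_diff[OF this] have "(\<lambda>i. c (i + 2) * z ^ (i + 2)) sums 0"
      by (simp add: c_def algebra_simps)
    moreover have "c i * z ^ i = 0" if "i < 2" for i
      using that by (simp add: c_def)
    ultimately show ?thesis
      using sums_zero_iff_shift[of 2 "\<lambda>i. c i * z ^ i" 0] by blast
  qed
  have "c k \<noteq> 0" "k > 0" using \<open>a k \<noteq> b k\<close> \<open>k \<ge> 2\<close> by (auto simp: c_def)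
  \<comment> \<open>A power series with a nonzero coefficient has an isolated zero at the origin.\<close>
  show False
  proof (rule powser_0_nonzero[of 1 0 c "\<lambda>_. 0" k])
    show "(\<lambda>i. c i * (z - 0) ^ i) sums 0" if "norm (z - 0) < 1" for z
      using sums that by simp
    fix s :: real
    assume "0 < s" and isolated: "\<And>z::complex. z \<in> cball 0 s - {0} \<Longrightarrow> (0::complex) \<noteq> 0"
    show False
      using isolated[of "of_real s"] \<open>0 < s\<close> by simp
  qed (use \<open>c k \<noteq> 0\<close> \<open>k > 0\<close> in simp_all)
qed

lemma normalized_expansion_monomial_iff:
  assumes "m \<ge> 2"
  shows "normalized_expansion f (\<lambda>k. if k = m then c else 0)
           \<longleftrightarrow> (\<forall>z\<in>ball 0 1. f z = z + c * z ^ m)"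
proof -
  have sums: "(\<lambda>k. (if k + 2 = m then c else 0) * z ^ (k + 2)) sums (c * z ^ m)" for z
  proof -
    have "(\<lambda>k. if k = m - 2 then c * z ^ m else 0) sums (c * z ^ m)"
      by (rule sums_single)
    also have "(\<lambda>k. if k = m - 2 then c * z ^ m else 0)
                 = (\<lambda>k. (if k + 2 = m then c else 0) * z ^ (k + 2))"
    proof (intro ext)
      fix k
      have "k = m - 2 \<longleftrightarrow> k + 2 = m" using assms by linarith
      thus "(if k = m - 2 then c * z ^ m else 0) = (if k + 2 = m then c else 0) * z ^ (k + 2)"
        by (cases "k + 2 = m") simp_all
    qed
    finally show ?thesis .
  qed
  have "(\<lambda>k. (if k + 2 = m then c else 0) * z ^ (k + 2)) sums (f z - z)
          \<longleftrightarrow> f z = z + c * z ^ m" for z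
  proof -
    have "(\<lambda>k. (if k + 2 = m then c else 0) * z ^ (k + 2)) sums (f z - z)
            \<longleftrightarrow> c * z ^ m = f z - z"
      using sums[of z] sums_unique2[OF sums[of z], of "f z - z"] by fastforce
    thus ?thesis by (auto simp: algebra_simps)
  qed
  thus ?thesis
    by (simp add: normalized_expansion_def)
qed

text \<open>
  Membership in the class bounds the weighted sum for one expansion of \<open>f\<close>; by uniqueness of the
  coefficients the bound passes to every expansion.
\<close>

lemma hurwitz_class_finite_sum_le:
  assumes "f \<in> hurwitz_class" and "normalized_expansion f a" and "finite S" and "S \<subseteq> {2..}"
  shows "(\<Sum>k\<in>S. real k * norm (a k)) \<le> 1"
proof -
  from assms(1) obtain b where b: "normalized_expansion f b"
      "summable (\<lambda>k. real (k + 2) * norm (b (k + 2)))"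
      "(\<Sum>k. real (k + 2) * norm (b (k + 2))) \<le> 1"
    by (auto simp: hurwitz_class_def)
  have inj: "inj_on (\<lambda>k. k - 2) S"
    using assms(4) by (auto simp: inj_on_def subset_iff) (metis eq_diff_iff)
  have "(\<Sum>k\<in>S. real k * norm (a k))
          = (\<Sum>k\<in>S. real (k - 2 + 2) * norm (b (k - 2 + 2)))"
  proof (intro sum.cong refl)
    fix k assume "k \<in> S"
    hence "k \<ge> 2" using assms(4) by auto
    thus "real k * norm (a k) = real (k - 2 + 2) * norm (b (k - 2 + 2))"
      by (simp only: le_add_diff_inverse2 normalized_expansion_unique[OF assms(2) b(1)])
  qed
  also have "\<dots> = (\<Sum>k\<in>(\<lambda>k. k - 2) ` S. real (k + 2) * norm (b (k + 2)))"
    by (simp add: sum.reindex[OF inj])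
  also have "\<dots> \<le> (\<Sum>k. real (k + 2) * norm (b (k + 2)))"
    using b(2) assms(3) by (intro sum_le_suminf) auto
  finally show ?thesis using b(3) by linarith
qed

corollary hurwitz_class_two_coefficients_le:
  assumes "f \<in> hurwitz_class" and "normalized_expansion f a"
    and "i \<ge> 2" and "j \<ge> 2" and "i \<noteq> j"
  shows "real i * norm (a i) + real j * norm (a j) \<le> 1"
  using hurwitz_class_finite_sum_le[OF assms(1,2), of "{i, j}"] assms(3-) by simp

text \<open>
  If one term of the weighted sum equals \<open>1\<close>, no room is left for the others, and \<open>\<alpha> = m a\<^sub>m\<close> is the
  required unimodular number.
\<close>

lemma hurwitz_coefficient_extremal_iff:
  assumes "f \<in> hurwitz_class" and "normalized_expansion f a" and "m \<ge> 2"
  shows "real m * norm (a m) = 1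
           \<longleftrightarrow> (\<exists>\<alpha>. norm \<alpha> = 1 \<and> (\<forall>z\<in>ball 0 1. f z = z + \<alpha> / of_nat m * z ^ m))"
proof
  assume extremal: "real m * norm (a m) = 1"
  have zero: "a k = 0" if "k \<ge> 2" "k \<noteq> m" for k
  proof -
    have "real k * norm (a k) \<le> 0"
      using hurwitz_class_two_coefficients_le[OF assms that(1)] that(2) extremal by simp
    thus ?thesis using that(1) by (simp add: mult_le_0_iff)
  qed
  have "(if k + 2 = m then a m else 0) = a (k + 2)" for k
    using zero[of "k + 2"] by auto
  hence "normalized_expansion f (\<lambda>k. if k = m then a m else 0)
          \<longleftrightarrow> normalized_expansion f a"
    unfolding normalized_expansion_def by presburger
  hence "\<forall>z\<in>ball 0 1. f z = z + a m * z ^ m"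
    using assms(2,3) by (simp add: normalized_expansion_monomial_iff)
  thus "\<exists>\<alpha>. norm \<alpha> = 1 \<and> (\<forall>z\<in>ball 0 1. f z = z + \<alpha> / of_nat m * z ^ m)"
    using extremal assms(3) by (intro exI[of _ "of_nat m * a m"]) (auto simp: norm_mult)
next
  assume "\<exists>\<alpha>. norm \<alpha> = 1 \<and> (\<forall>z\<in>ball 0 1. f z = z + \<alpha> / of_nat m * z ^ m)"
  then obtain \<alpha> :: complex where \<alpha>: "norm \<alpha> = 1"
      "normalized_expansion f (\<lambda>k. if k = m then \<alpha> / of_nat m else 0)"
    using assms(3) by (auto simp: normalized_expansion_monomial_iff)
  have "a m = \<alpha> / of_nat m"
    using normalized_expansion_unique[OF assms(2) \<alpha>(2) assms(3)] by simp
  thus "real m * norm (a m) = 1"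
    using \<alpha>(1) assms(3) by (simp add: norm_divide)
qed

text \<open>
  Both claims follow from \<open>p x\<^sup>2 + q y \<le> max p q (x\<^sup>2 + y) \<le> max p q (x + y) \<le> max p q\<close>. Equality in the
  second step forces \<open>x\<^sup>2 = x\<close>, in the third \<open>x + y = 1\<close>, which leaves the two corners.
\<close>

lemma quadratic_on_triangle:
  fixes p q x y :: real
  assumes "p > 0" and "q > 0" and "x \<ge> 0" and "y \<ge> 0" and "x + y \<le> 1"
  shows "p * x\<^sup>2 + q * y \<le> max p q"
    and "p * x\<^sup>2 + q * y = max p q \<longleftrightarrow> (p \<le> q \<and> y = 1) \<or> (p \<ge> q \<and> x = 1)"
proof -
  let ?M = "max p q"
  have "p * x\<^sup>2 \<le> ?M * x\<^sup>2" "q * y \<le> ?M * y"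
    using assms by (auto intro!: mult_right_mono)
  moreover have "x\<^sup>2 \<le> x"
    using assms by (simp add: power2_eq_square mult_left_le)
  hence "?M * x\<^sup>2 \<le> ?M * x"
    using assms by (intro mult_left_mono) auto
  moreover have "?M * x + ?M * y \<le> ?M"
    using assms mult_left_mono[of "x + y" 1 ?M] by (simp add: distrib_left)
  ultimately show "p * x\<^sup>2 + q * y \<le> ?M" by linarith
  show "p * x\<^sup>2 + q * y = ?M \<longleftrightarrow> (p \<le> q \<and> y = 1) \<or> (p \<ge> q \<and> x = 1)"
  proof
    assume eq: "p * x\<^sup>2 + q * y = ?M"
    have "?M * x\<^sup>2 = ?M * x" "?M * x + ?M * y = ?M"
      using eq \<open>p * x\<^sup>2 \<le> ?M * x\<^sup>2\<close> \<open>q * y \<le> ?M * y\<close> \<open>?M * x\<^sup>2 \<le> ?M * x\<close>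
        \<open>?M * x + ?M * y \<le> ?M\<close> by linarith+
    moreover have "?M \<noteq> 0" using assms by auto
    ultimately have "x\<^sup>2 = x" "?M * (x + y) = ?M * 1" by (auto simp: distrib_left)
    with \<open>?M \<noteq> 0\<close> have "x = 0 \<or> x = 1" "x + y = 1"
      by (auto simp: power2_eq_square simp del: mult_1_right)
    thus "(p \<le> q \<and> y = 1) \<or> (p \<ge> q \<and> x = 1)"
      using eq by auto
  next
    assume "(p \<le> q \<and> y = 1) \<or> (p \<ge> q \<and> x = 1)"
    thus "p * x\<^sup>2 + q * y = ?M"
    proof
      assume "p \<le> q \<and> y = 1"
      moreover from this have "x = 0" using assms by auto
      ultimately show ?thesis by simp
    next
      assume "p \<ge> q \<and> x = 1"
      moreover from this have "y = 0" using assms by auto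
      ultimately show ?thesis by simp
    qed
  qed
qed

theorem theorem6:
  fixes lam :: real and f :: "complex \<Rightarrow> complex" and a :: "nat \<Rightarrow> complex" and n :: nat
  assumes "lam > 0"
    and "f \<in> hurwitz_class"
    and "normalized_expansion f a"
    and "n \<ge> 2"
  shows "norm (complex_of_real lam * (a n)\<^sup>2 - a (2 * n - 1))
           \<le> max (lam / (real n)\<^sup>2) (1 / real (2 * n - 1)) \<and>
         (norm (complex_of_real lam * (a n)\<^sup>2 - a (2 * n - 1))
             = max (lam / (real n)\<^sup>2) (1 / real (2 * n - 1)) \<longleftrightarrow>
          (lam \<le> (real n)\<^sup>2 / real (2 * n - 1) \<and>
             (\<exists>\<alpha>::complex. norm \<alpha> = 1 \<and>
                (\<forall>z\<in>ball 0 1. f z = z + \<alpha> / of_nat (2 * n - 1) * z ^ (2 * n - 1)))) \<or>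
          (lam \<ge> (real n)\<^sup>2 / real (2 * n - 1) \<and>
             (\<exists>\<alpha>::complex. norm \<alpha> = 1 \<and>
                (\<forall>z\<in>ball 0 1. f z = z + \<alpha> / of_nat n * z ^ n))))"
proof -
  define m where "m = 2 * n - 1"
  have m: "m \<ge> 2" "n \<noteq> m" using assms(4) by (auto simp: m_def)
  define p q where "p = lam / (real n)\<^sup>2" and "q = 1 / real m"
  define x y where "x = real n * norm (a n)" and "y = real m * norm (a m)"
  define F where "F = norm (complex_of_real lam * (a n)\<^sup>2 - a m)"
  have pos: "p > 0" "q > 0" "x \<ge> 0" "y \<ge> 0"
    using assms(1,4) m by (auto simp: p_def q_def x_def y_def)
  have xy: "x + y \<le> 1"
    using hurwitz_class_two_coefficients_le[OF assms(2-4) m] by (simp add: x_def y_def)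
  have terms: "norm (complex_of_real lam * (a n)\<^sup>2) = p * x\<^sup>2" "norm (a m) = q * y"
    using assms(1,4) m
    by (auto simp: p_def q_def x_def y_def norm_mult norm_power power_mult_distrib)
  have F_le: "F \<le> p * x\<^sup>2 + q * y"
    unfolding F_def terms[symmetric] by (rule norm_triangle_ineq4)
  note tri = quadratic_on_triangle[OF pos xy]
  have "F = max p q \<longleftrightarrow> (p \<le> q \<and> y = 1) \<or> (p \<ge> q \<and> x = 1)"
  proof
    assume "F = max p q"
    thus "(p \<le> q \<and> y = 1) \<or> (p \<ge> q \<and> x = 1)" using F_le tri by linarith
  next
    assume corner: "(p \<le> q \<and> y = 1) \<or> (p \<ge> q \<and> x = 1)"
    hence "x = 0 \<or> y = 0" using pos xy by linarith
    hence "a n = 0 \<or> a m = 0" using assms(4) m by (auto simp: x_def y_def)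
    hence "F = p * x\<^sup>2 + q * y"
      unfolding F_def terms[symmetric] by auto
    thus "F = max p q" using tri(2) corner by simp
  qed
  moreover have "p \<le> q \<longleftrightarrow> lam \<le> (real n)\<^sup>2 / real m" "p \<ge> q \<longleftrightarrow> lam \<ge> (real n)\<^sup>2 / real m"
    using assms(4) m by (auto simp: p_def q_def field_simps)
  moreover have "F \<le> max p q" using F_le tri(1) by linarith
  ultimately show ?thesis
    using hurwitz_coefficient_extremal_iff[OF assms(2,3) m(1)]
      hurwitz_coefficient_extremal_iff[OF assms(2,3,4)]
    unfolding F_def p_def q_def x_def y_def m_def by simp
qed

end
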